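(* Let $\mathcal{X}$ be a non-empty finite set, let $N\geq 1$ and let $\underline{P}^N$ be a coherent exchangeable lower prevision on $\mathcal{L}(\mathcal{X}^N)$, with count distribution $\underline{Q}^N$ on $\mathcal{L}(\mathcal{N}^N)$ given by $\underline{Q}^N(h):=\underline{P}^N(h\circ\mathbf{T}^N)$. Let $f$ be any gamble on $\mathcal{X}^N$. Then: 1. The gamble $\hat f:=\frac{1}{|\mathcal{P}_N|}\sum_{\pi\in\mathcal{P}_N}\pi f$ on $\mathcal{X}^N$ is permutation invariant, i.e. $\pi\hat f=\hat f$ for all $\pi\in\mathcal{P}_N$. It is therefore constant on the permutation invariant atoms of $\mathcal{X}^N$, and it is also given by $$\hat f=\sum_{\mathbf{m}\in\mathcal{N}^N}I_{[\mathbf{m}]}\,\mathrm{MuHy}^N(f|\mathbf{m}).$$ 2. $\underline{P}^N(f-\hat f)=\underline{P}^N(\hat f-f)=0$, and therefore also $\underline{P}^N(f)=\underline{P}^N(\hat f)$. 3. $\underline{P}^N(f)=\underline{Q}^N(\mathrm{MuHy}^N(f|\cdot))$, where $\mathrm{MuHy}^N(f|\cdot)$ is the gamble on $\mathcal{N}^N$ that assumes the value $\mathrm{MuHy}^N(f|\mathbf{m})$ in $\mathbf{m}\in\mathcal{N}^N$. Consequently, a lower prevision on $\mathcal{L}(\mathcal{X}^N)$ is (coherent and) exchangeable if and only if it has the form $f\mapsto\underline{Q}(\mathrm{MuHy}^N(f|\cdot))$, where $\underline{Q}$ is any coherent lower prevision on $\mathcal{L}(\mathcal{N}^N)$.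
   Context: A gamble on a non-empty set $\mathcal{Z}$ is a bounded map $\mathcal{Z}\to\mathbb{R}$; $\mathcal{L}(\mathcal{Z})$ is the linear space of all gambles on $\mathcal{Z}$. $I_A$ denotes the indicator of $A$. A lower prevision on a set of gambles is a real-valued functional on it. A lower prevision $\underline{P}$ on a linear space of gambles $\mathcal{K}$ is coherent iff for all $f,g\in\mathcal{K}$ and real $\lambda\geq0$: $\underline{P}(f)\geq\inf f$; $\underline{P}(\lambda f)=\lambda\underline{P}(f)$; $\underline{P}(f+g)\geq\underline{P}(f)+\underline{P}(g)$. $\mathcal{P}_N$ is the set of all permutations of $\{1,\dots,N\}$. For $\pi\in\mathcal{P}_N$ and $\mathbf{x}=(x_1,\dots,x_N)\in\mathcal{X}^N$, $\pi\mathbf{x}:=(x_{\pi(1)},\dots,x_{\pi(N)})$, and for a gamble $f$ on $\mathcal{X}^N$, $(\pi f)(\mathbf{x}):=f(\pi\mathbf{x})$. A lower prevision $\underline{P}^N$ on $\mathcal{L}(\mathcal{X}^N)$ is called exchangeable if it is coherent and $\underline{P}^N(\pi f-f)\geq0$ for all gambles $f$ on $\mathcal{X}^N$ and all $\pi\in\mathcal{P}_N$ (equivalently, by coherence, $\underline{P}^N(\pi f-f)=\underline{P}^N(f-\pi f)=0$ for all such $f,\pi$). The permutation invariant atoms of $\mathcal{X}^N$ are the sets $\{\pi\mathbf{x}:\pi\in\mathcal{P}_N\}$, $\mathbf{x}\in\mathcal{X}^N$. The set of count vectors is $\mathcal{N}^N:=\{\mathbf{m}\in\mathbb{Z}_{\geq0}^{\mathcal{X}}:\sum_{x\in\mathcal{X}}m_x=N\}$.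 The counting map $\mathbf{T}^N:\mathcal{X}^N\to\mathcal{N}^N$ has components $T^N_x(\mathbf{z}):=|\{k\in\{1,\dots,N\}:z_k=x\}|$. For $\mathbf{m}\in\mathcal{N}^N$, $[\mathbf{m}]:=\{\mathbf{z}\in\mathcal{X}^N:\mathbf{T}^N(\mathbf{z})=\mathbf{m}\}$ (these are exactly the permutation invariant atoms), $\nu(\mathbf{m}):=|[\mathbf{m}]|=N!/\prod_{x\in\mathcal{X}}m_x!$, and for gambles $f$ on $\mathcal{X}^N$, $$\mathrm{MuHy}^N(f|\mathbf{m}):=\frac{1}{\nu(\mathbf{m})}\sum_{\mathbf{z}\in[\mathbf{m}]}f(\mathbf{z}).$$ *)

theory Defs
  imports "HOL-Analysis.Analysis" "HOL-Library.FuncSet"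
    "HOL-Combinatorics.Permutations"
begin

text \<open>
  A map on a set \<open>Z\<close> is represented by an extensional function, i.e. one that takes the value
  \<open>undefined\<close> outside \<open>Z\<close>. Equality of two gambles on \<open>Z\<close> is then HOL equality, and a functional
  on gambles can depend on nothing but their values on \<open>Z\<close>. The linear structure is
  pointwise on \<open>Z\<close>, written with \<open>\<lambda>z\<in>Z. \<dots>\<close>.
\<close>

definition gambles :: "'z set \<Rightarrow> ('z \<Rightarrow> real) set" where
  "gambles Z = {f \<in> extensional Z. bounded (f ` Z)}"

text \<open>
  A lower prevision on the linear space \<open>gambles Z\<close> is a total HOL function of which only the
  values on \<open>gambles Z\<close> matter.
\<close>

definition coherent :: "'z set \<Rightarrow> (('z \<Rightarrow> real) \<Rightarrow> real) \<Rightarrow> bool" where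
  "coherent Z P \<longleftrightarrow>
     (\<forall>f\<in>gambles Z. P f \<ge> (INF z\<in>Z. f z)) \<and>
     (\<forall>f\<in>gambles Z. \<forall>c::real. c \<ge> 0 \<longrightarrow> P (\<lambda>z\<in>Z. c * f z) = c * P f) \<and>
     (\<forall>f\<in>gambles Z. \<forall>g\<in>gambles Z. P (\<lambda>z\<in>Z. f z + g z) \<ge> P f + P g)"

definition perms :: "nat \<Rightarrow> (nat \<Rightarrow> nat) set" where
  "perms N = {\<pi>. \<pi> permutes {1..N}}"

definition tuples :: "'a set \<Rightarrow> nat \<Rightarrow> (nat \<Rightarrow> 'a) set" where
  "tuples X N = {1..N} \<rightarrow>\<^sub>E X"

text \<open>
  For \<open>\<pi> \<in> perms N\<close> and \<open>x \<in> tuples X N\<close> the composition below is again an element of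
  \<open>tuples X N\<close>, because \<open>\<pi>\<close> is the identity outside \<open>{1..N}\<close>.
\<close>

definition perm_tuple :: "(nat \<Rightarrow> nat) \<Rightarrow> (nat \<Rightarrow> 'a) \<Rightarrow> (nat \<Rightarrow> 'a)" where
  "perm_tuple \<pi> x = (\<lambda>k. x (\<pi> k))"

definition perm_gamble ::
    "'a set \<Rightarrow> nat \<Rightarrow> (nat \<Rightarrow> nat) \<Rightarrow> ((nat \<Rightarrow> 'a) \<Rightarrow> real) \<Rightarrow> ((nat \<Rightarrow> 'a) \<Rightarrow> real)" where
  "perm_gamble X N \<pi> f = (\<lambda>x\<in>tuples X N. f (perm_tuple \<pi> x))"

definition exchangeable :: "'a set \<Rightarrow> nat \<Rightarrow> (((nat \<Rightarrow> 'a) \<Rightarrow> real) \<Rightarrow> real) \<Rightarrow> bool" where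
  "exchangeable X N P \<longleftrightarrow>
     coherent (tuples X N) P \<and>
     (\<forall>f\<in>gambles (tuples X N). \<forall>\<pi>\<in>perms N.
        P (\<lambda>x\<in>tuples X N. perm_gamble X N \<pi> f x - f x) \<ge> 0)"

definition perm_atoms :: "'a set \<Rightarrow> nat \<Rightarrow> (nat \<Rightarrow> 'a) set set" where
  "perm_atoms X N = {{perm_tuple \<pi> x |\<pi>. \<pi> \<in> perms N} |x. x \<in> tuples X N}"

definition count_vectors :: "'a set \<Rightarrow> nat \<Rightarrow> ('a \<Rightarrow> nat) set" where
  "count_vectors X N = {m \<in> extensional X. (\<Sum>x\<in>X. m x) = N}"

definition counting_map :: "'a set \<Rightarrow> nat \<Rightarrow> (nat \<Rightarrow> 'a) \<Rightarrow> ('a \<Rightarrow> nat)" where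
  "counting_map X N z = (\<lambda>x\<in>X. card {k \<in> {1..N}. z k = x})"

definition count_class :: "'a set \<Rightarrow> nat \<Rightarrow> ('a \<Rightarrow> nat) \<Rightarrow> (nat \<Rightarrow> 'a) set" where
  "count_class X N m = {z \<in> tuples X N. counting_map X N z = m}"

definition MuHy :: "'a set \<Rightarrow> nat \<Rightarrow> ((nat \<Rightarrow> 'a) \<Rightarrow> real) \<Rightarrow> ('a \<Rightarrow> nat) \<Rightarrow> real" where
  "MuHy X N f = (\<lambda>m\<in>count_vectors X N.
     (1 / real (card (count_class X N m))) * (\<Sum>z\<in>count_class X N m. f z))"

definition count_distribution ::
    "'a set \<Rightarrow> nat \<Rightarrow> (((nat \<Rightarrow> 'a) \<Rightarrow> real) \<Rightarrow> real) \<Rightarrow> (('a \<Rightarrow> nat) \<Rightarrow> real) \<Rightarrow> real" where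
  "count_distribution X N P h = P (\<lambda>z\<in>tuples X N. h (counting_map X N z))"

definition sym_gamble ::
    "'a set \<Rightarrow> nat \<Rightarrow> ((nat \<Rightarrow> 'a) \<Rightarrow> real) \<Rightarrow> ((nat \<Rightarrow> 'a) \<Rightarrow> real)" where
  "sym_gamble X N f = (\<lambda>x\<in>tuples X N.
     (1 / real (card (perms N))) * (\<Sum>\<pi>\<in>perms N. perm_gamble X N \<pi> f x))"

end

theory Submission
  imports Defs
begin

text \<open>
  Two tuples have the same counts exactly when one is a permutation of the other, so each class
  \<open>[m]\<close> is a single orbit of the symmetric group. Averaging \<open>f\<close> over the group at a tuple \<open>x\<close> is
  therefore the same as averaging \<open>f\<close> uniformly over the orbit of \<open>x\<close>. This is lemma
  \<open>sym_gamble_eq_MuHy\<close>, by which the symmetrised gamble is \<open>MuHy\<close> of \<open>f\<close> composed with the counting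
  map. Its invariance, its constancy on atoms and its expansion in indicators of classes all
  follow from this factorisation.

  The differences between \<open>f\<close> and its symmetrisation, in either direction, are averages of
  differences \<open>\<pi>g - g\<close>, on which an exchangeable lower prevision is non-negative. By superadditivity
  it is non-negative on both, and because their sum is zero it vanishes on both. Hence \<open>P\<close> takes
  the same value at \<open>f\<close> and at its symmetrisation, and the latter is by the factorisation the
  value of the count distribution at \<open>MuHy\<close> of \<open>f\<close>.

  For the characterisation, the count distribution of an exchangeable \<open>P\<close> is coherent because
  \<open>h \<mapsto> h \<circ> T\<close>, with \<open>T\<close> the counting map, is linear and keeps the infimum. Conversely,
  \<open>f \<mapsto> MuHy f\<close> is linear, does not lower the infimum, and sends every \<open>\<pi>f - f\<close> to zero, so
  composing it with a coherent \<open>Q\<close> gives an exchangeable lower prevision.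
\<close>

section \<open>Coherent lower previsions on a finite set\<close>

lemma gambles_finite: "finite Z \<Longrightarrow> gambles Z = extensional Z"
  by (auto simp: gambles_def intro: finite_imp_bounded)

lemma coherent_ge_Inf:
  "coherent Z P \<Longrightarrow> f \<in> gambles Z \<Longrightarrow> P f \<ge> (INF z\<in>Z. f z)"
  by (simp add: coherent_def)

lemma coherent_scale:
  "coherent Z P \<Longrightarrow> f \<in> gambles Z \<Longrightarrow> c \<ge> 0 \<Longrightarrow> P (\<lambda>z\<in>Z. c * f z) = c * P f"
  by (simp add: coherent_def)

lemma coherent_superadd:
  "coherent Z P \<Longrightarrow> f \<in> gambles Z \<Longrightarrow> g \<in> gambles Z \<Longrightarrow> P (\<lambda>z\<in>Z. f z + g z) \<ge> P f + P g"
  by (simp add: coherent_def)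

lemma coherent_zero:
  assumes "coherent Z P"
  shows "P (\<lambda>z\<in>Z. 0) = 0"
proof -
  have "(\<lambda>z\<in>Z. 0) \<in> gambles Z"
    by (auto simp: gambles_def bounded_iff)
  from coherent_scale[OF assms this, of 0] show ?thesis
    by simp
qed

lemma coherent_sum_nonneg:
  assumes P: "coherent Z P" and Z: "finite Z" and I: "finite I"
    and nonneg: "\<And>i. i \<in> I \<Longrightarrow> P (\<lambda>z\<in>Z. g i z) \<ge> 0"
  shows "P (\<lambda>z\<in>Z. \<Sum>i\<in>I. g i z) \<ge> 0"
  using I nonneg
proof (induction I)
  case empty
  show ?case using coherent_zero[OF P] by (simp only: sum.empty order_refl)
next
  case (insert i I)
  have "P (\<lambda>z\<in>Z. g i z) + P (\<lambda>z\<in>Z. \<Sum>i\<in>I. g i z)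
      \<le> P (\<lambda>z\<in>Z. (\<lambda>z\<in>Z. g i z) z + (\<lambda>z\<in>Z. \<Sum>i\<in>I. g i z) z)"
    by (rule coherent_superadd[OF P]) (simp_all add: gambles_finite[OF Z])
  also have "(\<lambda>z\<in>Z. (\<lambda>z\<in>Z. g i z) z + (\<lambda>z\<in>Z. \<Sum>i\<in>I. g i z) z) = (\<lambda>z\<in>Z. \<Sum>i\<in>insert i I. g i z)"
    using insert.hyps by (auto simp: fun_eq_iff)
  finally have "P (\<lambda>z\<in>Z. g i z) + P (\<lambda>z\<in>Z. \<Sum>i\<in>I. g i z) \<le> P (\<lambda>z\<in>Z. \<Sum>i\<in>insert i I. g i z)" .
  moreover have "P (\<lambda>z\<in>Z. g i z) \<ge> 0"
    by (rule insert.prems) simp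
  moreover have "P (\<lambda>z\<in>Z. \<Sum>i\<in>I. g i z) \<ge> 0"
    by (rule insert.IH, rule insert.prems) simp
  ultimately show ?case by linarith
qed

lemma coherent_eq_if_diff_nonneg:
  assumes P: "coherent Z P" and Z: "finite Z" and f: "f \<in> extensional Z" and g: "g \<in> extensional Z"
    and fg: "P (\<lambda>z\<in>Z. f z - g z) \<ge> 0" and gf: "P (\<lambda>z\<in>Z. g z - f z) \<ge> 0"
  shows "P (\<lambda>z\<in>Z. f z - g z) = 0" "P (\<lambda>z\<in>Z. g z - f z) = 0" "P f = P g"
proof -
  \<comment> \<open>The two differences add up to zero, where \<open>P\<close> vanishes; superadditivity then bounds the
      sum of two non-negative values by zero.\<close>
  have "P (\<lambda>z\<in>Z. f z - g z) + P (\<lambda>z\<in>Z. g z - f z)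
      \<le> P (\<lambda>z\<in>Z. (\<lambda>z\<in>Z. f z - g z) z + (\<lambda>z\<in>Z. g z - f z) z)"
    by (rule coherent_superadd[OF P]) (simp_all add: gambles_finite[OF Z])
  also have "(\<lambda>z\<in>Z. (\<lambda>z\<in>Z. f z - g z) z + (\<lambda>z\<in>Z. g z - f z) z) = (\<lambda>z\<in>Z. 0)"
    by (auto simp: fun_eq_iff)
  finally have "P (\<lambda>z\<in>Z. f z - g z) + P (\<lambda>z\<in>Z. g z - f z) \<le> 0"
    by (simp only: coherent_zero[OF P])
  with fg gf show "P (\<lambda>z\<in>Z. f z - g z) = 0" "P (\<lambda>z\<in>Z. g z - f z) = 0"
    by linarith+
  have le: "P a \<le> P b"
    if a: "a \<in> extensional Z" and b: "b \<in> extensional Z" and ba: "P (\<lambda>z\<in>Z. b z - a z) \<ge> 0" for a b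
  proof -
    have "P a + P (\<lambda>z\<in>Z. b z - a z) \<le> P (\<lambda>z\<in>Z. a z + (\<lambda>z\<in>Z. b z - a z) z)"
      using a by (intro coherent_superadd[OF P]) (simp_all add: gambles_finite[OF Z])
    also have "(\<lambda>z\<in>Z. a z + (\<lambda>z\<in>Z. b z - a z) z) = b"
      using b by (auto simp: fun_eq_iff extensional_def)
    finally show ?thesis using ba by linarith
  qed
  show "P f = P g"
    using le[OF f g gf] le[OF g f fg] by simp
qed


section \<open>Count classes are the orbits of the symmetric group\<close>

lemma finite_tuples: "finite X \<Longrightarrow> finite (tuples X N)"
  by (simp add: tuples_def finite_PiE)

lemma tuples_nonempty: "X \<noteq> {} \<Longrightarrow> tuples X N \<noteq> {}"
  by (simp add: tuples_def PiE_eq_empty_iff)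

lemma finite_perms: "finite (perms N)"
  by (simp add: perms_def finite_permutations)

lemma card_perms_pos: "card (perms N) > 0"
proof -
  have "id \<in> perms N"
    by (simp add: perms_def permutes_id)
  with finite_perms show ?thesis
    by (metis card_gt_0_iff empty_iff)
qed

lemma inv_in_perms: "\<pi> \<in> perms N \<Longrightarrow> inv \<pi> \<in> perms N"
  by (simp add: perms_def permutes_inv)

lemma perm_tuple_in_tuples:
  assumes "\<pi> \<in> perms N" "x \<in> tuples X N"
  shows "perm_tuple \<pi> x \<in> tuples X N"
proof -
  have "\<pi> k \<in> {1..N} \<longleftrightarrow> k \<in> {1..N}" for k
    using assms(1) unfolding perms_def by (metis mem_Collect_eq permutes_in_image)
  with assms(2) show ?thesis
    unfolding tuples_def perm_tuple_def PiE_iff extensional_def by blast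
qed

lemma perm_tuple_comp: "perm_tuple \<pi> (perm_tuple \<sigma> x) = perm_tuple (\<sigma> \<circ> \<pi>) x"
  by (simp add: perm_tuple_def)

lemma perm_tuple_inv:
  assumes "\<pi> \<in> perms N"
  shows "perm_tuple \<pi> (perm_tuple (inv \<pi>) x) = x" "perm_tuple (inv \<pi>) (perm_tuple \<pi> x) = x"
  using assms by (simp_all add: perm_tuple_def perms_def permutes_inverses)

text \<open>
  Counts are the multiplicities in the multiset of values of a tuple; this reduces statements on
  permuted tuples to statements on multisets.
\<close>

lemma counting_map_eq_count:
  "counting_map X N z = (\<lambda>x\<in>X. count (image_mset z (mset_set {1..N})) x)"
  by (auto simp: counting_map_def fun_eq_iff count_image_mset vimage_def Int_def
      intro!: arg_cong[where f = card])

lemma counting_map_perm_tuple: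
  assumes "\<pi> \<in> perms N"
  shows "counting_map X N (perm_tuple \<pi> x) = counting_map X N x"
proof -
  have "image_mset \<pi> (mset_set {1..N}) = mset_set {1..N}"
    using assms
    by (simp add: perms_def permutes_image[of \<pi> "{1..N}"] permutes_inj_on[of \<pi> "{1..N}"]
        image_mset_mset_set del: One_nat_def)
  then have "image_mset (perm_tuple \<pi> x) (mset_set {1..N}) = image_mset x (mset_set {1..N})"
    using multiset.map_comp[of x \<pi> "mset_set {1..N}"] by (simp add: perm_tuple_def comp_def)
  then show ?thesis by (simp add: counting_map_eq_count)
qed

lemma perm_tuple_if_same_counts:
  assumes x: "x \<in> tuples X N" and y: "y \<in> tuples X N"
    and eq: "counting_map X N x = counting_map X N y"
  obtains \<pi> where "\<pi> \<in> perms N" "y = perm_tuple \<pi> x"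
proof -
  have "image_mset y (mset_set {1..N}) = image_mset x (mset_set {1..N})"
  proof (rule multiset_eqI)
    fix a
    show "count (image_mset y (mset_set {1..N})) a = count (image_mset x (mset_set {1..N})) a"
    proof (cases "a \<in> X")
      case True
      then show ?thesis using fun_cong[OF eq, of a] by (simp add: counting_map_eq_count)
    next
      case False
      then have "a \<notin># image_mset y (mset_set {1..N})" "a \<notin># image_mset x (mset_set {1..N})"
        using x y by (auto simp: tuples_def)
      then show ?thesis by (metis not_in_iff)
    qed
  qed
  then obtain \<pi> where \<pi>: "\<pi> permutes {1..N}" "\<forall>k\<in>{1..N}. y k = x (\<pi> k)"
    using image_mset_eq_implies_permutes[of "{1..N}" y x] by auto
  have "y k = perm_tuple \<pi> x k" for k
    using \<pi> x y
    by (cases "k \<in> {1..N}")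
      (auto simp: perm_tuple_def tuples_def PiE_iff extensional_def permutes_not_in)
  with \<pi> that[of \<pi>] show thesis by (auto simp: perms_def)
qed

lemma counting_map_in_count_vectors:
  assumes "finite X" "z \<in> tuples X N"
  shows "counting_map X N z \<in> count_vectors X N"
proof -
  have "(\<Sum>x\<in>X. card {k \<in> {1..N}. z k = x}) = card (\<Union>x\<in>X. {k \<in> {1..N}. z k = x})"
    using assms by (intro card_UN_disjoint[symmetric]) auto
  also have "(\<Union>x\<in>X. {k \<in> {1..N}. z k = x}) = {1..N}"
    using assms by (auto simp: tuples_def)
  finally show ?thesis
    by (simp add: count_vectors_def counting_map_def)
qed

text \<open>
  Every count vector is attained, so that no class average divides by zero: list its values with
  their multiplicities.
\<close>

lemma count_vector_attained:
  assumes X: "finite X" and m: "m \<in> count_vectors X N"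
  obtains z where "z \<in> tuples X N" "counting_map X N z = m"
proof -
  define M where "M = (\<Sum>x\<in>X. replicate_mset (m x) x)"
  obtain xs where xs: "mset xs = M"
    using ex_mset by blast
  have len: "length xs = N"
    using m arg_cong[OF xs, of size] by (simp add: M_def count_vectors_def)
  have set: "set xs \<subseteq> X"
    using X arg_cong[OF xs, of set_mset] by (auto simp: M_def set_mset_sum split: if_splits)
  define z where "z = (\<lambda>k\<in>{1..N}. xs ! (k - 1))"
  have "z \<in> tuples X N"
    using set len by (auto simp: z_def tuples_def subset_iff)
  moreover have "image_mset z (mset_set {1..N}) = M"
  proof -
    have "image_mset z (mset_set {1..N}) = mset (map z [1..<Suc N])"
      by (simp only: mset_map mset_upt atLeastLessThanSuc_atLeastAtMost)
    also have "map z [1..<Suc N] = xs"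
      using len by (intro map_upt_eqI) (auto simp: z_def)
    finally show ?thesis using xs by simp
  qed
  then have "counting_map X N z = m"
    using X m
    by (auto simp: counting_map_eq_count M_def count_sum count_vectors_def fun_eq_iff
        extensional_def)
  ultimately show thesis by (rule that)
qed

lemma counting_map_image:
  "finite X \<Longrightarrow> counting_map X N ` tuples X N = count_vectors X N"
  by (auto intro: counting_map_in_count_vectors elim: count_vector_attained)

lemma finite_count_vectors: "finite X \<Longrightarrow> finite (count_vectors X N)"
  using counting_map_image[of X N] finite_tuples[of X N] by (metis finite_imageI)

lemma finite_count_class: "finite X \<Longrightarrow> finite (count_class X N m)"
  by (simp add: count_class_def finite_tuples)

lemma card_count_class_pos:
  assumes "finite X" "m \<in> count_vectors X N"
  shows "card (count_class X N m) > 0"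
  using count_vector_attained[OF assms] finite_count_class[OF assms(1), of N m]
  by (auto simp: card_gt_0_iff count_class_def)


section \<open>Group averages are class averages\<close>

lemma sum_count_class_perm:
  assumes \<pi>: "\<pi> \<in> perms N"
  shows "(\<Sum>z\<in>count_class X N m. f (perm_tuple \<pi> z)) = (\<Sum>z\<in>count_class X N m. f z)"
  by (rule sum.reindex_bij_witness[of _ "perm_tuple (inv \<pi>)" "perm_tuple \<pi>"])
    (use \<pi> in \<open>auto simp: perm_tuple_inv count_class_def counting_map_perm_tuple
      perm_tuple_in_tuples inv_in_perms\<close>)

lemma sum_perms_invariant:
  assumes \<sigma>: "\<sigma> \<in> perms N"
  shows "(\<Sum>\<pi>\<in>perms N. f (perm_tuple \<pi> (perm_tuple \<sigma> x))) = (\<Sum>\<pi>\<in>perms N. f (perm_tuple \<pi> x))"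
  unfolding perm_tuple_comp
  by (rule sum.reindex_bij_witness[of _ "\<lambda>\<pi>. inv \<sigma> \<circ> \<pi>" "\<lambda>\<pi>. \<sigma> \<circ> \<pi>"])
    (use \<sigma> in \<open>auto simp: perms_def permutes_compose permutes_inv permutes_inv_o
      simp flip: comp_assoc\<close>)

text \<open>
  The double sum of \<open>f (\<pi>z)\<close> over permutations \<open>\<pi>\<close> and over \<open>z\<close> in the class of \<open>x\<close> is computed in
  both orders. Each \<open>\<pi>\<close> permutes the class, and each \<open>z\<close> in the class gives the same sum over \<open>\<pi>\<close>
  as \<open>x\<close>, because it is itself a permutation of \<open>x\<close>. This avoids counting stabilisers.
\<close>

lemma sym_gamble_eq_MuHy:
  assumes X: "finite X" and x: "x \<in> tuples X N"
  shows "sym_gamble X N f x = MuHy X N f (counting_map X N x)"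
proof -
  define m where "m = counting_map X N x"
  define C where "C = count_class X N m"
  have m: "m \<in> count_vectors X N"
    using counting_map_in_count_vectors[OF X x] by (simp add: m_def)
  have "real (card (perms N)) * (\<Sum>z\<in>C. f z) = (\<Sum>\<pi>\<in>perms N. \<Sum>z\<in>C. f (perm_tuple \<pi> z))"
    by (simp add: C_def sum_count_class_perm)
  also have "\<dots> = (\<Sum>z\<in>C. \<Sum>\<pi>\<in>perms N. f (perm_tuple \<pi> z))"
    by (rule sum.swap)
  also have "\<dots> = (\<Sum>z\<in>C. \<Sum>\<pi>\<in>perms N. f (perm_tuple \<pi> x))"
  proof (rule sum.cong)
    fix z assume "z \<in> C"
    then have z: "z \<in> tuples X N" and eq: "counting_map X N x = counting_map X N z"
      by (auto simp: C_def count_class_def m_def)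
    then obtain \<sigma> where "\<sigma> \<in> perms N" "z = perm_tuple \<sigma> x"
      using perm_tuple_if_same_counts[OF x] by blast
    then show "(\<Sum>\<pi>\<in>perms N. f (perm_tuple \<pi> z)) = (\<Sum>\<pi>\<in>perms N. f (perm_tuple \<pi> x))"
      by (simp add: sum_perms_invariant)
  qed simp
  also have "\<dots> = real (card C) * (\<Sum>\<pi>\<in>perms N. f (perm_tuple \<pi> x))"
    by simp
  finally have "real (card (perms N)) * (\<Sum>z\<in>C. f z)
      = real (card C) * (\<Sum>\<pi>\<in>perms N. f (perm_tuple \<pi> x))" .
  moreover have "card C > 0"
    using card_count_class_pos[OF X m] by (simp add: C_def)
  ultimately have "(1 / real (card (perms N))) * (\<Sum>\<pi>\<in>perms N. f (perm_tuple \<pi> x))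
      = (1 / real (card C)) * (\<Sum>z\<in>C. f z)"
    using card_perms_pos[of N] by (simp add: field_simps)
  then show ?thesis
    using x m by (simp add: sym_gamble_def perm_gamble_def MuHy_def C_def flip: m_def)
qed

lemma sym_gamble_eq_MuHy_counting_map:
  "finite X \<Longrightarrow> sym_gamble X N f = (\<lambda>x\<in>tuples X N. MuHy X N f (counting_map X N x))"
  by (auto simp: fun_eq_iff sym_gamble_eq_MuHy) (simp add: sym_gamble_def)

lemma MuHy_in_gambles: "finite X \<Longrightarrow> MuHy X N f \<in> gambles (count_vectors X N)"
  by (simp add: gambles_finite finite_count_vectors MuHy_def)

lemma sym_gamble_invariant:
  assumes "finite X" "\<pi> \<in> perms N"
  shows "perm_gamble X N \<pi> (sym_gamble X N f) = sym_gamble X N f"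
  using assms
  by (auto simp: fun_eq_iff sym_gamble_eq_MuHy_counting_map perm_gamble_def perm_tuple_in_tuples
      counting_map_perm_tuple)

lemma sym_gamble_constant_on_atom:
  assumes "finite X" "A \<in> perm_atoms X N"
  shows "sym_gamble X N f constant_on A"
proof -
  obtain x where "x \<in> tuples X N" "A = {perm_tuple \<pi> x |\<pi>. \<pi> \<in> perms N}"
    using assms(2) by (auto simp: perm_atoms_def)
  then have "\<forall>z\<in>A. sym_gamble X N f z = MuHy X N f (counting_map X N x)"
    using assms(1) by (auto simp: sym_gamble_eq_MuHy perm_tuple_in_tuples counting_map_perm_tuple)
  then show ?thesis by (auto simp: constant_on_def)
qed

lemma sym_gamble_eq_indicator_sum:
  assumes X: "finite X"
  shows "sym_gamble X N f = (\<lambda>x\<in>tuples X N. \<Sum>m\<in>count_vectors X N.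
           indicator (count_class X N m) x * MuHy X N f m)"
proof -
  have "(\<Sum>m\<in>count_vectors X N. indicator (count_class X N m) x * MuHy X N f m)
      = MuHy X N f (counting_map X N x)" if x: "x \<in> tuples X N" for x
  proof -
    have "(\<Sum>m\<in>count_vectors X N. indicator (count_class X N m) x * MuHy X N f m)
        = (\<Sum>m\<in>count_vectors X N. if counting_map X N x = m then MuHy X N f m else 0)"
      using x by (intro sum.cong) (auto simp: indicator_def count_class_def)
    then show ?thesis
      using counting_map_in_count_vectors[OF X x] finite_count_vectors[OF X] by simp
  qed
  then show ?thesis
    by (auto simp: sym_gamble_eq_MuHy_counting_map[OF X] fun_eq_iff)
qed


section \<open>Exchangeable lower previsions do not see the symmetrisation\<close>

lemma exchangeable_diff_sym_nonneg:
  assumes X: "finite X" and P: "exchangeable X N P" and f: "f \<in> gambles (tuples X N)"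
  shows "P (\<lambda>x\<in>tuples X N. sym_gamble X N f x - f x) \<ge> 0"
    and "P (\<lambda>x\<in>tuples X N. f x - sym_gamble X N f x) \<ge> 0"
proof -
  let ?Z = "tuples X N" and ?c = "1 / real (card (perms N))"
  have coh: "coherent ?Z P" and
    exch: "\<And>g \<pi>. g \<in> gambles ?Z \<Longrightarrow> \<pi> \<in> perms N \<Longrightarrow> P (\<lambda>x\<in>?Z. perm_gamble X N \<pi> g x - g x) \<ge> 0"
    using P by (auto simp: exchangeable_def)
  have avg: "P (\<lambda>x\<in>?Z. ?c * (\<Sum>\<pi>\<in>perms N. g \<pi> x)) \<ge> 0"
    if "\<And>\<pi>. \<pi> \<in> perms N \<Longrightarrow> P (\<lambda>x\<in>?Z. g \<pi> x) \<ge> 0" for g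
  proof -
    have "(\<lambda>x\<in>?Z. \<Sum>\<pi>\<in>perms N. g \<pi> x) \<in> gambles ?Z"
      using X by (simp only: gambles_finite finite_tuples restrict_extensional)
    then have "P (\<lambda>x\<in>?Z. ?c * (\<lambda>x\<in>?Z. \<Sum>\<pi>\<in>perms N. g \<pi> x) x)
        = ?c * P (\<lambda>x\<in>?Z. \<Sum>\<pi>\<in>perms N. g \<pi> x)"
      by (rule coherent_scale[OF coh]) simp
    moreover have "(\<lambda>x\<in>?Z. ?c * (\<lambda>x\<in>?Z. \<Sum>\<pi>\<in>perms N. g \<pi> x) x)
        = (\<lambda>x\<in>?Z. ?c * (\<Sum>\<pi>\<in>perms N. g \<pi> x))"
      by (auto simp: fun_eq_iff)
    moreover have "P (\<lambda>x\<in>?Z. \<Sum>\<pi>\<in>perms N. g \<pi> x) \<ge> 0"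
      by (rule coherent_sum_nonneg[OF coh finite_tuples[OF X] finite_perms that])
    ultimately show ?thesis
      by (metis mult_nonneg_nonneg of_nat_0_le_iff zero_le_divide_1_iff)
  qed
  have "(\<lambda>x\<in>?Z. sym_gamble X N f x - f x)
      = (\<lambda>x\<in>?Z. ?c * (\<Sum>\<pi>\<in>perms N. perm_gamble X N \<pi> f x - f x))"
    using card_perms_pos[of N]
    by (auto simp: fun_eq_iff sym_gamble_def sum_subtractf field_simps)
  then show "P (\<lambda>x\<in>?Z. sym_gamble X N f x - f x) \<ge> 0"
    using avg[of "\<lambda>\<pi> x. perm_gamble X N \<pi> f x - f x"] exch[OF f] by simp
  have swapped: "P (\<lambda>x\<in>?Z. f x - perm_gamble X N \<pi> f x) \<ge> 0" if \<pi>: "\<pi> \<in> perms N" for \<pi>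
  proof -
    \<comment> \<open>The reversed difference is \<open>\<sigma>g - g\<close> for \<open>g = \<pi>f\<close> and \<open>\<sigma>\<close> the inverse of \<open>\<pi>\<close>.\<close>
    let ?g = "perm_gamble X N \<pi> f"
    have "(\<lambda>x\<in>?Z. perm_gamble X N (inv \<pi>) ?g x - ?g x) = (\<lambda>x\<in>?Z. f x - ?g x)"
      using \<pi> by (auto simp: fun_eq_iff perm_gamble_def perm_tuple_in_tuples inv_in_perms
          perm_tuple_inv)
    moreover have "?g \<in> gambles ?Z"
      using X by (simp add: gambles_finite finite_tuples perm_gamble_def)
    ultimately show ?thesis
      using exch[OF _ inv_in_perms[OF \<pi>]] by metis
  qed
  have "(\<lambda>x\<in>?Z. f x - sym_gamble X N f x)
      = (\<lambda>x\<in>?Z. ?c * (\<Sum>\<pi>\<in>perms N. f x - perm_gamble X N \<pi> f x))"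
    using card_perms_pos[of N]
    by (auto simp: fun_eq_iff sym_gamble_def sum_subtractf field_simps)
  then show "P (\<lambda>x\<in>?Z. f x - sym_gamble X N f x) \<ge> 0"
    using avg[of "\<lambda>\<pi> x. f x - perm_gamble X N \<pi> f x"] swapped by simp
qed

lemma sym_gamble_in_gambles: "finite X \<Longrightarrow> sym_gamble X N f \<in> gambles (tuples X N)"
  by (simp add: gambles_finite finite_tuples sym_gamble_def)

lemma exchangeable_sym_gamble:
  assumes X: "finite X" and P: "exchangeable X N P" and f: "f \<in> gambles (tuples X N)"
  shows "P (\<lambda>x\<in>tuples X N. f x - sym_gamble X N f x) = 0"
    and "P (\<lambda>x\<in>tuples X N. sym_gamble X N f x - f x) = 0"
    and "P f = P (sym_gamble X N f)"
proof -
  have coh: "coherent (tuples X N) P"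
    using P by (simp add: exchangeable_def)
  have ext: "f \<in> extensional (tuples X N)" "sym_gamble X N f \<in> extensional (tuples X N)"
    using f by (simp_all add: gambles_def sym_gamble_def)
  note * = coherent_eq_if_diff_nonneg[OF coh finite_tuples[OF X] ext
      exchangeable_diff_sym_nonneg(2,1)[OF X P f]]
  show "P (\<lambda>x\<in>tuples X N. f x - sym_gamble X N f x) = 0"
    and "P (\<lambda>x\<in>tuples X N. sym_gamble X N f x - f x) = 0"
    and "P f = P (sym_gamble X N f)"
    by (fact *)+
qed

lemma exchangeable_eq_count_distribution:
  assumes "finite X" "exchangeable X N P" "f \<in> gambles (tuples X N)"
  shows "P f = count_distribution X N P (MuHy X N f)"
  using exchangeable_sym_gamble(3)[OF assms] assms(1)
  by (simp add: count_distribution_def sym_gamble_eq_MuHy_counting_map)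


section \<open>Exchangeable lower previsions from lower previsions on counts\<close>

lemma coherent_count_distribution:
  assumes X: "finite X" "X \<noteq> {}" and P: "coherent (tuples X N) P"
  shows "coherent (count_vectors X N) (count_distribution X N P)"
proof -
  let ?Z = "tuples X N" and ?M = "count_vectors X N"
  let ?T = "counting_map X N" and ?Q = "count_distribution X N P"
  have lift: "(\<lambda>z\<in>?Z. h (?T z)) \<in> gambles ?Z" for h :: "('a \<Rightarrow> nat) \<Rightarrow> real"
    using X by (simp add: gambles_finite finite_tuples)
  note T = counting_map_in_count_vectors[OF X(1)]
  show ?thesis
    unfolding coherent_def
  proof (intro conjI ballI allI impI)
    fix h :: "('a \<Rightarrow> nat) \<Rightarrow> real"
    have "(INF m\<in>?M. h m) = (INF z\<in>?Z. (\<lambda>z\<in>?Z. h (?T z)) z)"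
      by (simp add: image_image flip: counting_map_image[OF X(1), of N] cong: image_cong_simp)
    also have "\<dots> \<le> ?Q h"
      unfolding count_distribution_def by (rule coherent_ge_Inf[OF P lift])
    finally show "?Q h \<ge> (INF m\<in>?M. h m)" .
  next
    fix h :: "('a \<Rightarrow> nat) \<Rightarrow> real" and c :: real
    assume "c \<ge> 0"
    from coherent_scale[OF P lift[of h] this]
    show "?Q (\<lambda>m\<in>?M. c * h m) = c * ?Q h"
      by (simp add: count_distribution_def T cong: restrict_cong)
  next
    fix h h' :: "('a \<Rightarrow> nat) \<Rightarrow> real"
    from coherent_superadd[OF P lift[of h] lift[of h']]
    show "?Q (\<lambda>m\<in>?M. h m + h' m) \<ge> ?Q h + ?Q h'"
      by (simp add: count_distribution_def T cong: restrict_cong)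
  qed
qed

lemma MuHy_scale:
  "MuHy X N (\<lambda>x\<in>tuples X N. c * f x) = (\<lambda>m\<in>count_vectors X N. c * MuHy X N f m)"
  by (auto simp: MuHy_def fun_eq_iff count_class_def sum_distrib_left sum_divide_distrib mult_ac)

lemma MuHy_add:
  "MuHy X N (\<lambda>x\<in>tuples X N. f x + g x) = (\<lambda>m\<in>count_vectors X N. MuHy X N f m + MuHy X N g m)"
  by (auto simp: MuHy_def fun_eq_iff count_class_def sum.distrib distrib_left add_divide_distrib)

text \<open>
  A permutation maps each class bijectively onto itself, so \<open>\<pi>f\<close> and \<open>f\<close> have equal sums over it.
\<close>

lemma MuHy_perm_diff:
  assumes "\<pi> \<in> perms N"
  shows "MuHy X N (\<lambda>x\<in>tuples X N. perm_gamble X N \<pi> f x - f x) = (\<lambda>m\<in>count_vectors X N. 0)"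
proof -
  have "(\<Sum>z\<in>count_class X N m. (\<lambda>x\<in>tuples X N. perm_gamble X N \<pi> f x - f x) z)
      = (\<Sum>z\<in>count_class X N m. f (perm_tuple \<pi> z) - f z)" for m
    by (rule sum.cong) (auto simp: count_class_def perm_gamble_def)
  then show ?thesis
    by (simp add: MuHy_def fun_eq_iff sum_subtractf sum_count_class_perm[OF assms])
qed

lemma MuHy_ge_Inf:
  assumes X: "finite X" and m: "m \<in> count_vectors X N"
  shows "MuHy X N f m \<ge> (INF x\<in>tuples X N. f x)"
proof -
  let ?C = "count_class X N m"
  have "(INF x\<in>tuples X N. f x) \<le> f z" if "z \<in> ?C" for z
    using that X by (intro cINF_lower) (auto simp: count_class_def finite_tuples)
  then have "real (card ?C) * (INF x\<in>tuples X N. f x) \<le> (\<Sum>z\<in>?C. f z)"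
    using sum_bounded_below[of ?C "INF x\<in>tuples X N. f x" f] by simp
  then show ?thesis
    using card_count_class_pos[OF X m] m by (simp add: MuHy_def field_simps)
qed

lemma exchangeable_if_MuHy:
  assumes X: "finite X" "X \<noteq> {}" and Q: "coherent (count_vectors X N) Q"
    and PQ: "\<And>f. f \<in> gambles (tuples X N) \<Longrightarrow> P f = Q (MuHy X N f)"
  shows "exchangeable X N P"
proof -
  let ?Z = "tuples X N" and ?M = "count_vectors X N"
  have PQ': "P (\<lambda>x\<in>?Z. f x) = Q (MuHy X N (\<lambda>x\<in>?Z. f x))" for f
    using X by (intro PQ) (simp add: gambles_finite finite_tuples)
  note MuHy = MuHy_in_gambles[OF X(1)]
  have "?M \<noteq> {}"
    using tuples_nonempty[OF X(2), of N] counting_map_in_count_vectors[OF X(1)] by blast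
  show ?thesis
    unfolding exchangeable_def coherent_def
  proof (intro conjI ballI allI impI)
    fix f assume f: "f \<in> gambles ?Z"
    have "(INF x\<in>?Z. f x) \<le> (INF m\<in>?M. MuHy X N f m)"
      using \<open>?M \<noteq> {}\<close> MuHy_ge_Inf[OF X(1)] by (rule cINF_greatest)
    also have "\<dots> \<le> P f"
      unfolding PQ[OF f] by (rule coherent_ge_Inf[OF Q MuHy])
    finally show "(INF x\<in>?Z. f x) \<le> P f" .
  next
    fix f and c :: real
    assume "f \<in> gambles ?Z" "c \<ge> 0"
    then show "P (\<lambda>x\<in>?Z. c * f x) = c * P f"
      by (simp add: PQ PQ' MuHy_scale coherent_scale[OF Q MuHy])
  next
    fix f g
    assume "f \<in> gambles ?Z" "g \<in> gambles ?Z"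
    then show "P (\<lambda>x\<in>?Z. f x + g x) \<ge> P f + P g"
      by (simp add: PQ PQ' MuHy_add coherent_superadd[OF Q MuHy MuHy])
  next
    fix f \<pi> assume "\<pi> \<in> perms N"
    then show "P (\<lambda>x\<in>?Z. perm_gamble X N \<pi> f x - f x) \<ge> 0"
      by (simp add: PQ' MuHy_perm_diff coherent_zero[OF Q])
  qed
qed

lemma exchangeable_iff_MuHy:
  assumes X: "finite X" "X \<noteq> {}"
  shows "exchangeable X N P \<longleftrightarrow>
    (\<exists>Q. coherent (count_vectors X N) Q \<and> (\<forall>f\<in>gambles (tuples X N). P f = Q (MuHy X N f)))"
    (is "_ \<longleftrightarrow> ?factors")
proof
  assume P: "exchangeable X N P"
  then have "coherent (count_vectors X N) (count_distribution X N P)"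
    by (intro coherent_count_distribution X) (simp add: exchangeable_def)
  with exchangeable_eq_count_distribution[OF X(1) P] show ?factors
    by blast
next
  assume ?factors
  then show "exchangeable X N P"
    using exchangeable_if_MuHy[OF X] by blast
qed

theorem theorem2:
  fixes X :: "'a set" and N :: nat
  assumes "finite X" and "X \<noteq> {}" and "N \<ge> 1"
  shows
    "(\<forall>P. exchangeable X N P \<longrightarrow>
       (\<forall>f\<in>gambles (tuples X N).
          let fh = sym_gamble X N f in
          (fh \<in> gambles (tuples X N) \<and>
           (\<forall>\<pi>\<in>perms N. perm_gamble X N \<pi> fh = fh) \<and>
           (\<forall>A\<in>perm_atoms X N. fh constant_on A) \<and>
           fh = (\<lambda>x\<in>tuples X N. \<Sum>m\<in>count_vectors X N.
                   indicator (count_class X N m) x * MuHy X N f m)) \<and>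
          (P (\<lambda>x\<in>tuples X N. f x - fh x) = 0 \<and>
           P (\<lambda>x\<in>tuples X N. fh x - f x) = 0 \<and>
           P f = P fh) \<and>
          (MuHy X N f \<in> gambles (count_vectors X N) \<and>
           P f = count_distribution X N P (MuHy X N f)))) \<and>
     (\<forall>P. exchangeable X N P \<longleftrightarrow>
       (\<exists>Q. coherent (count_vectors X N) Q \<and>
            (\<forall>f\<in>gambles (tuples X N). P f = Q (MuHy X N f))))"
proof (intro conjI allI impI ballI)
  fix P f
  assume "exchangeable X N P" and "f \<in> gambles (tuples X N)"
  note Pf = assms(1) this
  show "let fh = sym_gamble X N f in
          (fh \<in> gambles (tuples X N) \<and>
           (\<forall>\<pi>\<in>perms N. perm_gamble X N \<pi> fh = fh) \<and>
           (\<forall>A\<in>perm_atoms X N. fh constant_on A) \<and>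
           fh = (\<lambda>x\<in>tuples X N. \<Sum>m\<in>count_vectors X N.
                   indicator (count_class X N m) x * MuHy X N f m)) \<and>
          (P (\<lambda>x\<in>tuples X N. f x - fh x) = 0 \<and>
           P (\<lambda>x\<in>tuples X N. fh x - f x) = 0 \<and>
           P f = P fh) \<and>
          (MuHy X N f \<in> gambles (count_vectors X N) \<and>
           P f = count_distribution X N P (MuHy X N f))"
    unfolding Let_def
    by (intro conjI ballI sym_gamble_in_gambles sym_gamble_invariant sym_gamble_constant_on_atom
        sym_gamble_eq_indicator_sum MuHy_in_gambles exchangeable_sym_gamble
        exchangeable_eq_count_distribution Pf)
qed (rule exchangeable_iff_MuHy[OF assms(1,2)])

end
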